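(* The point $A=(v_2,v_6,v_1,v_3,v_5)^\top=(1,0,0,0,0)^\top$ is PNS-free.
   Context: A fourth order four dimensional Hankel tensor $\mathcal{A}=(a_{i_1i_2i_3i_4})$ with generating vector $\mathbf{v}=(v_0,\ldots,v_{12})^\top\in\mathbb{R}^{13}$ is defined by $a_{i_1i_2i_3i_4}=v_{i_1+i_2+i_3+i_4-4}$ for $i_1,i_2,i_3,i_4\in\{1,2,3,4\}$. Its associated polynomial is $f(\mathbf{x})=\sum_{i_1,i_2,i_3,i_4=1}^4 v_{i_1+i_2+i_3+i_4-4}\,x_{i_1}x_{i_2}x_{i_3}x_{i_4}$, $\mathbf{x}\in\mathbb{R}^4$. $\mathcal{A}$ is PSD if $f(\mathbf{x})\ge 0$ for all $\mathbf{x}\in\mathbb{R}^4$; it is SOS if $f$ is a sum of squares of real quadratic homogeneous polynomials. Given $P=(v_2,v_6,v_1,v_3,v_5)^\top\in\mathbb{R}^5$ and $v_0\in\mathbb{R}$, $\mathcal{A}$ denotes the Hankel tensor with generating vector $(v_0,v_1,v_2,v_3,1,v_5,v_6,v_5,1,v_3,v_2,v_1,v_0)^\top$. $M_0(P)$ (respectively $N_0(P)$) denotes the smallest $v_0$ for which $\mathcal{A}$ is SOS (respectively PSD), so that $\mathcal{A}$ is SOS iff $v_0\ge M_0(P)$ and PSD iff $v_0\ge N_0(P)$. $P$ is called PNS-free if $M_0(P)$ and $N_0(P)$ exist and $M_0(P)=N_0(P)$. *)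

theory Defs
  imports "HOL-Analysis.Analysis"
begin

text \<open>
  A fourth order four dimensional tensor is given by its entries \<open>A i1 i2 i3 i4\<close>; only the
  indices in \<open>{1..4}\<close> are meaningful.  A generating vector in \<open>\<real>\<^sup>1\<^sup>3\<close> is a list of length 13
  whose entry \<open>v ! k\<close> is \<open>v\<^sub>k\<close>.
\<close>

type_synonym tensor4 = "nat \<Rightarrow> nat \<Rightarrow> nat \<Rightarrow> nat \<Rightarrow> real"

definition hankel_tensor :: "real list \<Rightarrow> tensor4" where
  "hankel_tensor v i1 i2 i3 i4 = v ! (i1 + i2 + i3 + i4 - 4)"

text \<open>
  \<open>of_nat\<close> maps \<open>1, 2, 3, 4\<close> bijectively onto the index type \<open>4\<close> (where \<open>4 = 0\<close>), so
  \<open>x $ of_nat i\<close> is the usual \<open>i\<close>-th coordinate.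
\<close>

definition assoc_poly :: "tensor4 \<Rightarrow> real ^ 4 \<Rightarrow> real" where
  "assoc_poly A x =
     (\<Sum>i1\<in>{1..4}. \<Sum>i2\<in>{1..4}. \<Sum>i3\<in>{1..4}. \<Sum>i4\<in>{1..4}.
        A i1 i2 i3 i4 * x $ of_nat i1 * x $ of_nat i2 * x $ of_nat i3 * x $ of_nat i4)"

definition quadratic_form :: "(real ^ 4 \<Rightarrow> real) \<Rightarrow> bool" where
  "quadratic_form q \<longleftrightarrow>
     (\<exists>c :: nat \<Rightarrow> nat \<Rightarrow> real. \<forall>x.
        q x = (\<Sum>i\<in>{1..4}. \<Sum>j\<in>{1..4}. c i j * x $ of_nat i * x $ of_nat j))"

definition PSD_tensor :: "tensor4 \<Rightarrow> bool" where
  "PSD_tensor A \<longleftrightarrow> (\<forall>x. assoc_poly A x \<ge> 0)"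

text \<open>Real polynomials are identified with their polynomial functions, as \<open>\<real>\<close> is infinite.\<close>

definition SOS_tensor :: "tensor4 \<Rightarrow> bool" where
  "SOS_tensor A \<longleftrightarrow>
     (\<exists>(r :: nat) q. (\<forall>k<r. quadratic_form (q k)) \<and>
        (\<forall>x. assoc_poly A x = (\<Sum>k<r. (q k x)\<^sup>2)))"

text \<open>Points \<open>P\<close> list their coordinates in the order \<open>(v2, v6, v1, v3, v5)\<close>.\<close>

type_synonym point5 = "real \<times> real \<times> real \<times> real \<times> real"

fun hankel_of_point :: "point5 \<Rightarrow> real \<Rightarrow> tensor4" where
  "hankel_of_point (v2, v6, v1, v3, v5) v0 =
     hankel_tensor [v0, v1, v2, v3, 1, v5, v6, v5, 1, v3, v2, v1, v0]"

definition has_least :: "(real \<Rightarrow> bool) \<Rightarrow> bool" where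
  "has_least Q \<longleftrightarrow> (\<exists>m. Q m \<and> (\<forall>t. Q t \<longrightarrow> m \<le> t))"

text \<open>\<open>M0 P\<close> and \<open>N0 P\<close> are meaningful only when the corresponding least element exists.\<close>

definition M0 :: "point5 \<Rightarrow> real" where
  "M0 P = (LEAST v0. SOS_tensor (hankel_of_point P v0))"

definition N0 :: "point5 \<Rightarrow> real" where
  "N0 P = (LEAST v0. PSD_tensor (hankel_of_point P v0))"

definition PNS_free :: "point5 \<Rightarrow> bool" where
  "PNS_free P \<longleftrightarrow>
     has_least (\<lambda>v0. SOS_tensor (hankel_of_point P v0)) \<and>
     has_least (\<lambda>v0. PSD_tensor (hankel_of_point P v0)) \<and>
     M0 P = N0 P"

end

theory Submission
  imports Defs
begin

text \<open>
  On the vectors \<open>(1, t, t, 1)\<close> the form is \<open>2 v\<^sub>0 + 2 (t\<^sup>4 + 12 t\<^sup>3 + 12 t\<^sup>2 + 16 t)\<close>.  The quartic is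
  minimal at the real root of \<open>t\<^sup>3 + 9 t\<^sup>2 + 6 t + 4\<close>, which gives the lower bound
  \<open>21 t\<^sup>2 + 6 t + 12\<close> for \<open>v\<^sub>0\<close>.  For this value of \<open>v\<^sub>0\<close> there is an explicit sum of squares
  with coefficients in \<open>\<rat>(t)\<close>.  It is found by splitting the Gram matrix along the symmetries
  \<open>(x\<^sub>1, x\<^sub>2, x\<^sub>3, x\<^sub>4) \<mapsto> (x\<^sub>4, x\<^sub>3, x\<^sub>2, x\<^sub>1)\<close> and \<open>(x\<^sub>1, -x\<^sub>2, x\<^sub>3, -x\<^sub>4)\<close>, and requiring that every
  square vanishes at \<open>(1, t, t, 1)\<close>.
\<close>

lemma sum_1_4: "(\<Sum>i\<in>{1..4::nat}. f i) = f 1 + f 2 + f 3 + (f 4 :: 'a::comm_monoid_add)"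
  by (simp add: numeral_eq_Suc add.assoc)

lemma quadratic_form_monomial:
  assumes "i \<in> {1..4}" "j \<in> {1..4}"
  shows "quadratic_form (\<lambda>x. x $ of_nat i * x $ of_nat j)"
  unfolding quadratic_form_def
  using assms
  \<comment> \<open>Testing \<open>l\<close> first lets the inner sum collapse to one term and
    leaves the same pattern for the outer sum.\<close>
  by (intro exI[of _ "\<lambda>k l. if l = j then if k = i then 1 else 0 else 0"])
    (simp add: if_distrib[where f = "\<lambda>c. c * _"] cong: if_cong)

lemma quadratic_form_add:
  assumes "quadratic_form p" "quadratic_form q"
  shows "quadratic_form (\<lambda>x. p x + q x)"
proof -
  obtain c where c: "\<forall>x. p x = (\<Sum>i\<in>{1..4}. \<Sum>j\<in>{1..4}. c i j * x $ of_nat i * x $ of_nat j)"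
    using assms(1) unfolding quadratic_form_def by blast
  obtain d where d: "\<forall>x. q x = (\<Sum>i\<in>{1..4}. \<Sum>j\<in>{1..4}. d i j * x $ of_nat i * x $ of_nat j)"
    using assms(2) unfolding quadratic_form_def by blast
  show ?thesis
    unfolding quadratic_form_def c[rule_format] d[rule_format]
    by (intro exI[of _ "\<lambda>i j. c i j + d i j"]) (simp only: sum.distrib distrib_right simp_thms)
qed

lemma quadratic_form_cmult:
  assumes "quadratic_form p"
  shows "quadratic_form (\<lambda>x. a * p x)"
proof -
  obtain c where c: "\<forall>x. p x = (\<Sum>i\<in>{1..4}. \<Sum>j\<in>{1..4}. c i j * x $ of_nat i * x $ of_nat j)"
    using assms unfolding quadratic_form_def by blast
  show ?thesis
    unfolding quadratic_form_def c[rule_format]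
    by (intro exI[of _ "\<lambda>i j. a * c i j"]) (simp only: sum_distrib_left mult.assoc simp_thms)
qed

lemma quadratic_form_diff:
  "quadratic_form p \<Longrightarrow> quadratic_form q \<Longrightarrow> quadratic_form (\<lambda>x. p x - q x)"
  using quadratic_form_add[of p "\<lambda>x. -1 * q x"] quadratic_form_cmult[of q "-1"] by simp

text \<open>The ten products in the shape used by the certificate below, so that the introduction
  rules match syntactically.\<close>

lemmas quadratic_form_coordinates =
  quadratic_form_monomial[of 1 1, simplified] quadratic_form_monomial[of 1 2, simplified]
  quadratic_form_monomial[of 1 3, simplified] quadratic_form_monomial[of 1 4, simplified]
  quadratic_form_monomial[of 2 2, simplified] quadratic_form_monomial[of 2 3, simplified]
  quadratic_form_monomial[of 2 4, simplified] quadratic_form_monomial[of 3 3, simplified]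
  quadratic_form_monomial[of 3 4, simplified] quadratic_form_monomial[of 4 4, simplified]

lemmas quadratic_form_intros =
  quadratic_form_add quadratic_form_diff quadratic_form_cmult quadratic_form_coordinates

text \<open>Square roots absorb nonnegative weights into the forms, so the certificate can keep
  coefficients in \<rat>(t).\<close>

lemma SOS_tensorI:
  assumes "\<forall>q\<in>set qs. fst q \<ge> 0 \<and> quadratic_form (snd q)"
    and "\<And>x. assoc_poly A x = (\<Sum>(c, q)\<leftarrow>qs. c * (q x)\<^sup>2)"
  shows "SOS_tensor A"
  unfolding SOS_tensor_def
proof (intro exI conjI allI impI)
  let ?g = "\<lambda>k x. sqrt (fst (qs ! k)) * snd (qs ! k) x"
  show "quadratic_form (?g k)" if "k < length qs" for k
    using that assms(1) by (intro quadratic_form_cmult) simp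
  fix x
  have "assoc_poly A x = (\<Sum>k<length qs. fst (qs ! k) * (snd (qs ! k) x)\<^sup>2)"
    by (simp add: assms(2) sum_list_sum_nth case_prod_beta atLeast0LessThan)
  also have "\<dots> = (\<Sum>k<length qs. (?g k x)\<^sup>2)"
    using assms(1) by (intro sum.cong refl) (simp add: power_mult_distrib)
  finally show "assoc_poly A x = (\<Sum>k<length qs. (?g k x)\<^sup>2)" .
qed

lemma SOS_imp_PSD: "SOS_tensor A \<Longrightarrow> PSD_tensor A"
  unfolding SOS_tensor_def PSD_tensor_def by (metis sum_nonneg zero_le_power2)

lemma assoc_poly_hankel_of_point:
  fixes x :: "real ^ 4"
  defines "a \<equiv> x $ 1" and "b \<equiv> x $ 2" and "c \<equiv> x $ 3" and "d \<equiv> x $ 4"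
  shows "assoc_poly (hankel_of_point (1, 0, 0, 0, 0) v) x =
     v * (a^4 + d^4) + 4 * a^3 * c + 6 * a^2 * b^2 + 4 * d^3 * b + 6 * c^2 * d^2 + b^4 + c^4
     + 12 * a * b^2 * c + 6 * a^2 * c^2 + 12 * a^2 * b * d + 12 * b * c^2 * d + 6 * b^2 * d^2
     + 12 * a * c * d^2"
  unfolding assms assoc_poly_def hankel_of_point.simps hankel_tensor_def sum_1_4
  by simp (simp add: power2_eq_square power3_eq_cube power4_eq_xxxx algebra_simps)

text \<open>The first two squares use forms invariant under both symmetries, the next three forms
  that change sign under reversal, and the last two forms that change sign under the sign
  change.\<close>

lemma sos_identity:
  fixes a b c d t :: real
  assumes "t^3 + 9 * t^2 + 6 * t + 4 = 0"
  shows "(21 * t^2 + 6 * t + 12) * (a^4 + d^4) + 4 * a^3 * c + 6 * a^2 * b^2 + 4 * d^3 * b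
     + 6 * c^2 * d^2 + b^4 + c^4
     + 12 * a * b^2 * c + 6 * a^2 * c^2 + 12 * a^2 * b * d + 12 * b * c^2 * d + 6 * b^2 * d^2
     + 12 * a * c * d^2 =
     1/8 * (b*b + c*c - t^2 * (a*a + d*d))^2
     + (t^2 + 9*t + 6)/2 * (a*c + b*d - t * (a*a + d*d))^2
     + 7/8 * (b*b - c*c + (12 - 6*t - t^2)/7 * (a*a - d*d))^2
     + ((93*t^2 + 14*t + 60)/8 - (12 - 6*t - t^2)^2/56) * (a*a - d*d)^2
     + (6 - 6*t - t^2/2) * (a*c - b*d)^2
     + 3/2 * (b*c + 4 * (a*b + c*d) - (t^2 + 8*t) * (a*d))^2
     + (t^2 + 3*t - 42)/2 * (a*b + c*d - 2*t * (a*d))^2"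
  (is "?lhs = ?rhs")
proof -
  \<comment> \<open>The two sides agree only modulo the cubic; the second factor is the quotient,
    found monomial by monomial in \<open>a\<close>, \<open>b\<close>, \<open>c\<close>,
    \<open>d\<close>.\<close>
  have "?rhs - ?lhs = (t^3 + 9 * t^2 + 6 * t + 4) *
      ((5 * t - 9)/8 * (a^4 + d^4) - a^3 * c - d^3 * b - 3 * a * c * d^2 - 3 * a^2 * b * d
       + (19 * t - 15)/4 * a^2 * d^2)"
    by (simp add: power2_eq_square power3_eq_cube power4_eq_xxxx algebra_simps
        add_divide_distrib diff_divide_distrib)
  then show ?thesis
    using assms by simp
qed

text \<open>The interval serves to fix the signs of the weights. It is this narrow because
  \<open>t\<close> and \<open>t^2\<close> are later bounded separately, which leaves little room in
  \<open>t^2 + 9*t + 6\<close>.\<close>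

lemma cubic_root:
  obtains t :: real where "-8.34 < t" "t < -8.33" "t^3 + 9 * t^2 + 6 * t + 4 = 0"
proof -
  let ?p = "\<lambda>t::real. t^3 + 9 * t^2 + 6 * t + 4"
  have "\<exists>t. -8.34 \<le> t \<and> t \<le> -8.33 \<and> ?p t = 0"
    by (rule IVT') (auto simp: power3_eq_cube power2_eq_square intro!: continuous_intros)
  moreover have "?p (-8.34) \<noteq> 0" "?p (-8.33) \<noteq> 0"
    by (simp_all add: power3_eq_cube power2_eq_square)
  ultimately show thesis
    using that by (metis order_le_less)
qed

lemma SOS_at_root:
  fixes t :: real
  assumes t: "-8.34 < t" "t < -8.33" "t^3 + 9 * t^2 + 6 * t + 4 = 0"
  shows "SOS_tensor (hankel_of_point (1, 0, 0, 0, 0) (21 * t^2 + 6 * t + 12))"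
proof (rule SOS_tensorI)
  let ?qs = "[(1/8, \<lambda>x :: real^4. x$2 * x$2 + x$3 * x$3 - t^2 * (x$1 * x$1 + x$4 * x$4)),
     ((t^2 + 9*t + 6)/2, \<lambda>x. x$1 * x$3 + x$2 * x$4 - t * (x$1 * x$1 + x$4 * x$4)),
     (7/8, \<lambda>x. x$2 * x$2 - x$3 * x$3 + (12 - 6*t - t^2)/7 * (x$1 * x$1 - x$4 * x$4)),
     ((93*t^2 + 14*t + 60)/8 - (12 - 6*t - t^2)^2/56, \<lambda>x. x$1 * x$1 - x$4 * x$4),
     (6 - 6*t - t^2/2, \<lambda>x. x$1 * x$3 - x$2 * x$4),
     (3/2, \<lambda>x. x$2 * x$3 + 4 * (x$1 * x$2 + x$3 * x$4) - (t^2 + 8*t) * (x$1 * x$4)),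
     ((t^2 + 3*t - 42)/2, \<lambda>x. x$1 * x$2 + x$3 * x$4 - 2*t * (x$1 * x$4))]"
  show "assoc_poly (hankel_of_point (1, 0, 0, 0, 0) (21 * t^2 + 6 * t + 12)) x
      = (\<Sum>(c, q)\<leftarrow>?qs. c * (q x)\<^sup>2)" for x
    unfolding assoc_poly_hankel_of_point sos_identity[OF t(3)] by simp
  have "8.33^2 \<le> (-t)^2" "(-t)^2 \<le> 8.34^2"
    using t(1,2) by (intro power_mono; simp)+
  then have sq: "69.38 \<le> t^2" "t^2 \<le> 69.56"
    by (simp_all add: power2_eq_square)
  \<comment> \<open>Only the fourth weight is not linear in \<open>t\<close> and \<open>t^2\<close>;
    this crude bound limits its subtracted term to 100/56, while the rest is in the
    hundreds.\<close>
  have "\<bar>12 - 6*t - t^2\<bar> \<le> 10"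
    using t(1,2) sq by (intro abs_leI) simp_all
  then have "(12 - 6*t - t^2)^2 \<le> 10^2"
    by (metis abs_le_square_iff abs_numeral)
  then have pos: "0 \<le> (93*t^2 + 14*t + 60)/8 - (12 - 6*t - t^2)^2/56"
    "0 \<le> (t^2 + 9*t + 6)/2" "0 \<le> 6 - 6*t - t^2/2" "0 \<le> (t^2 + 3*t - 42)/2"
    using t(1,2) sq by auto
  show "\<forall>q\<in>set ?qs. fst q \<ge> 0 \<and> quadratic_form (snd q)"
    by (simp only: list.set ball_simps fst_conv snd_conv)
      (intro conjI; (intro quadratic_form_intros | rule pos | simp))
qed

lemma PSD_imp_ge_at_root:
  fixes t :: real
  assumes "t^3 + 9 * t^2 + 6 * t + 4 = 0"
    and "PSD_tensor (hankel_of_point (1, 0, 0, 0, 0) v)"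
  shows "21 * t^2 + 6 * t + 12 \<le> v"
proof -
  let ?z = "(\<chi> i. if i = 1 \<or> i = 4 then 1 else t) :: real^4"
  have "0 \<le> assoc_poly (hankel_of_point (1, 0, 0, 0, 0) v) ?z"
    using assms(2) by (simp add: PSD_tensor_def)
  also have "\<dots> = 2 * (v + t^4 + 12 * t^3 + 12 * t^2 + 16 * t)"
    unfolding assoc_poly_hankel_of_point by simp algebra
  \<comment> \<open>Division by the cubic: the quartic in \<open>t\<close> equals
    \<open>(t + 3)\<close> times the cubic minus \<open>21 * t^2 + 6 * t + 12\<close>.\<close>
  also have "\<dots> = 2 * (v - (21 * t^2 + 6 * t + 12))"
    using assms(1) by algebra
  finally show ?thesis by simp
qed

theorem theorem10:
  shows "PNS_free (1, 0, 0, 0, 0)"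
proof -
  obtain t :: real where t: "-8.34 < t" "t < -8.33" "t^3 + 9 * t^2 + 6 * t + 4 = 0"
    by (rule cubic_root)
  let ?m = "21 * t^2 + 6 * t + 12"
  have sos: "SOS_tensor (hankel_of_point (1, 0, 0, 0, 0) ?m)"
    by (rule SOS_at_root[OF t])
  have le: "?m \<le> v" if "PSD_tensor (hankel_of_point (1, 0, 0, 0, 0) v)" for v
    by (rule PSD_imp_ge_at_root[OF t(3) that])
  \<comment> \<open>As SOS implies PSD, \<open>sos\<close> shows that \<open>?m\<close> is attained
    for both properties and \<open>le\<close> that it is minimal for both.\<close>
  have "M0 (1, 0, 0, 0, 0) = ?m" "N0 (1, 0, 0, 0, 0) = ?m"
    unfolding M0_def N0_def using sos le by (auto intro!: Least_equality SOS_imp_PSD)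
  then show ?thesis
    unfolding PNS_free_def has_least_def using sos le SOS_imp_PSD by metis
qed

end
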